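(* For $\sigma>0$ let $p_0(x)=\frac{1}{\sigma\sqrt{2\pi}}e^{-x^2/(2\sigma^2)}$, $x\in\mathbb R$, be the centered Gaussian density, and let $$\mathcal H^{(1)}(\sigma)=\int_{\mathbb R}p_0(x)|\log p_0(x)|\,dx,\qquad \mathcal H^{(2)}(\sigma)=\int_{\mathbb R}p_0(x)(-\log p_0(x))_+\,dx,$$ $$\mathcal H^{(3)}(\sigma)=\int_{\mathbb R}p_0(x)\log\left((p_0(x))^{-1}+1\right)dx,\qquad \mathcal H^{(4)}(\sigma)=\int_{\mathbb R}\frac{p_0(x)}{M}\log\frac{M}{p_0(x)}\,dx,\quad M=\sup_{x\in\mathbb R}p_0(x).$$ Then: 1) $\mathcal H^{(1)}(\sigma)$ decreases for $\sigma\in(0,\sigma_0)$ and increases for $\sigma\in(\sigma_0,+\infty)$, where $\sigma_0\approx0.317777$ is the unique value (with $-\log(\sigma_0\sqrt{2\pi})>0$) for which $$\int_0^{-\log(\sigma_0\sqrt{2\pi})}\frac{e^{-z}}{\sqrt z}\,dz=\int_{-\log(\sigma_0\sqrt{2\pi})}^\infty\frac{e^{-z}}{\sqrt z}\,dz.$$ 2) For each $i\in\{2,3,4\}$, $\mathcal H^{(i)}(\sigma)$ strictly increases in $\sigma>0$ from $0$ to $+\infty$ (that is, it is strictly increasing on $(0,\infty)$, tends to $0$ as $\sigma\to0+$ and tends to $+\infty$ as $\sigma\to+\infty$).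
   Context: $\log$ is the natural logarithm and $a_+=\max(a,0)$. The functionals $\mathcal H^{(i)}$ are the alternative Shannon entropies $\mathcal H_{SH}^{(i)}$, $i=1,2,3,4$, evaluated at the density $p_0$ and regarded as functions of $\sigma$. *)

theory Defs
  imports "HOL-Probability.Distributions"
begin

(* Alternative Shannon entropies of a density p with respect to Lebesgue measure. *)

definition shannon_alt1 :: "(real \<Rightarrow> real) \<Rightarrow> real" where
  "shannon_alt1 p = (LBINT x. p x * \<bar>ln (p x)\<bar>)"

definition shannon_alt2 :: "(real \<Rightarrow> real) \<Rightarrow> real" where
  "shannon_alt2 p = (LBINT x. p x * max (- ln (p x)) 0)"

definition shannon_alt3 :: "(real \<Rightarrow> real) \<Rightarrow> real" where
  "shannon_alt3 p = (LBINT x. p x * ln (inverse (p x) + 1))"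

(* Sup on the reals is a junk value for an unbounded p; Gaussian densities are bounded. *)
definition shannon_alt4 :: "(real \<Rightarrow> real) \<Rightarrow> real" where
  "shannon_alt4 p = (let M = (SUP x. p x) in LBINT x. p x / M * ln (M / p x))"

lemma centered_normal_density_eq:
  assumes "0 < \<sigma>"
  shows "normal_density 0 \<sigma> x = 1 / (\<sigma> * sqrt (2 * pi)) * exp (- (x\<^sup>2) / (2 * \<sigma>\<^sup>2))"
  using assms by (simp add: normal_density_def real_sqrt_mult)

end

theory Submission
  imports Defs "HOL-Real_Asymp.Real_Asymp"
begin

text \<open>
  With \<open>t = ln (\<sigma> * sqrt (2 * pi))\<close> the Gaussian density satisfies
  \<open>- ln (normal_density 0 \<sigma> (\<sigma> * y)) = t + y\<^sup>2 / 2\<close>. Substituting \<open>x = \<sigma> * y\<close> therefore turns every entropy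
  of the form \<open>\<integral> p h (- ln p)\<close> into the expectation of \<open>h (t + Z)\<close>, where \<open>Z\<close> is half the square of a
  standard normal variable (\<open>normal_entropy_eq_expectation\<close>). The scale \<open>\<sigma>\<close> enters only through the
  shift \<open>t\<close>, which increases from \<open>-\<infinity>\<close> to \<open>\<infinity>\<close>.

  For the second and third entropies \<open>h\<close> is the positive part or its smooth analogue
  \<open>z \<mapsto> ln (exp z + 1)\<close>. Both are increasing, strictly so on the positive axis, which \<open>t + Z\<close> reaches
  with positive probability whatever \<open>t\<close> is; hence the expectation increases strictly in \<open>t\<close>. It tends
  to \<open>0\<close> at \<open>-\<infinity>\<close> by dominated convergence and is at least \<open>t + expectation Z\<close>, so it tends to \<open>\<infinity>\<close>.
  In the fourth entropy the division by the maximum of the density cancels the shift and leaves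
  \<open>\<sigma> * sqrt (2 * pi) / 2\<close>.

  The first entropy is the mean absolute deviation of \<open>Z\<close> from \<open>- t\<close>. Such a deviation grows as the
  reference point moves away from the median \<open>m\<close> of \<open>Z\<close>, on either side, so the entropy has its
  turning point at \<open>- t = m\<close>. Since \<open>Z\<close> has the Gamma distribution with shape \<open>1 / 2\<close>, being the median
  is exactly the stated balance of integrals of \<open>exp (- z) / sqrt z\<close>. The substitution \<open>z = x\<^sup>2\<close>
  rewrites both in terms of \<open>gauss_integral b\<close>, the integral of \<open>exp (- x\<^sup>2)\<close> over \<open>{0..b}\<close>: the median
  is \<open>m = q\<^sup>2\<close>, where \<open>q\<close> is the unique point at which this integral reaches half of its limit
  \<open>sqrt pi / 2\<close>. Alternating Taylor bounds for \<open>exp\<close> enclose \<open>q\<close>, and with it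
  \<open>exp (- q\<^sup>2) / sqrt (2 * pi)\<close>, the turning point in terms of \<open>\<sigma>\<close>.
\<close>

section \<open>Mean absolute deviation and the median\<close>

text \<open>
  Moving the reference point from \<open>c\<close> to \<open>c'\<close> adds \<open>c' - c\<close> to the deviation wherever \<open>Z \<le> c\<close> and removes
  at most \<open>c' - c\<close> elsewhere. If the former event is the likelier one, the expected deviation grows.
\<close>

lemma (in prob_space) expectation_abs_deviation_less_right:
  fixes Z :: "'a \<Rightarrow> real"
  assumes Z: "integrable M Z" and "c < c'" and med: "1 / 2 < prob {x \<in> space M. Z x \<le> c}"
  shows "expectation (\<lambda>x. \<bar>Z x - c\<bar>) < expectation (\<lambda>x. \<bar>Z x - c'\<bar>)"
proof -
  note [measurable] = borel_measurable_integrable[OF Z]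
  let ?A = "{x \<in> space M. Z x \<le> c}"
  have [simp]: "integrable M (indicat_real ?A)"
    by (intro integrable_real_indicator) (auto simp: less_top[symmetric])
  have "0 < (c' - c) * (2 * prob ?A - 1)"
    using \<open>c < c'\<close> med by simp
  also have "2 * prob ?A - 1 = expectation (\<lambda>x. 2 * indicator ?A x - 1)"
    by (subst Bochner_Integration.integral_diff) (simp_all add: prob_space less_top[symmetric])
  also have "(c' - c) * \<dots> = expectation (\<lambda>x. (c' - c) * (2 * indicator ?A x - 1))"
    by simp
  also have "\<dots> \<le> expectation (\<lambda>x. \<bar>Z x - c'\<bar> - \<bar>Z x - c\<bar>)"
  proof (rule integral_mono)
    fix x assume "x \<in> space M"
    then show "(c' - c) * (2 * indicator ?A x - 1) \<le> \<bar>Z x - c'\<bar> - \<bar>Z x - c\<bar>"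
      using \<open>c < c'\<close> by (auto split: split_indicator)
  qed (auto intro!: Bochner_Integration.integrable_diff Z integrable_abs)
  also have "\<dots> = expectation (\<lambda>x. \<bar>Z x - c'\<bar>) - expectation (\<lambda>x. \<bar>Z x - c\<bar>)"
    by (intro Bochner_Integration.integral_diff) (auto intro!: Z integrable_abs)
  finally show ?thesis by simp
qed

text \<open>
  The mirror image: moving from \<open>c'\<close> to \<open>c\<close> adds \<open>c' - c\<close> wherever \<open>Z > c'\<close> and removes at most
  \<open>c' - c\<close> elsewhere.
\<close>

lemma (in prob_space) expectation_abs_deviation_less_left:
  fixes Z :: "'a \<Rightarrow> real"
  assumes Z: "integrable M Z" and "c < c'" and med: "prob {x \<in> space M. Z x \<le> c'} < 1 / 2"
  shows "expectation (\<lambda>x. \<bar>Z x - c'\<bar>) < expectation (\<lambda>x. \<bar>Z x - c\<bar>)"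
proof -
  note [measurable] = borel_measurable_integrable[OF Z]
  let ?A = "{x \<in> space M. Z x \<le> c'}"
  have [simp]: "integrable M (indicat_real ?A)"
    by (intro integrable_real_indicator) (auto simp: less_top[symmetric])
  have "0 < (c' - c) * (1 - 2 * prob ?A)"
    using \<open>c < c'\<close> med by simp
  also have "1 - 2 * prob ?A = expectation (\<lambda>x. 1 - 2 * indicator ?A x)"
    by (subst Bochner_Integration.integral_diff) (simp_all add: prob_space less_top[symmetric])
  also have "(c' - c) * \<dots> = expectation (\<lambda>x. (c' - c) * (1 - 2 * indicator ?A x))"
    by simp
  also have "\<dots> \<le> expectation (\<lambda>x. \<bar>Z x - c\<bar> - \<bar>Z x - c'\<bar>)"
  proof (rule integral_mono)
    fix x assume "x \<in> space M"
    then show "(c' - c) * (1 - 2 * indicator ?A x) \<le> \<bar>Z x - c\<bar> - \<bar>Z x - c'\<bar>"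
      using \<open>c < c'\<close> by (auto split: split_indicator)
  qed (auto intro!: Bochner_Integration.integrable_diff Z integrable_abs)
  also have "\<dots> = expectation (\<lambda>x. \<bar>Z x - c\<bar>) - expectation (\<lambda>x. \<bar>Z x - c'\<bar>)"
    by (intro Bochner_Integration.integral_diff) (auto intro!: Z integrable_abs)
  finally show ?thesis by simp
qed

section \<open>Expectations of shifted soft positive parts\<close>

text \<open>
  The properties shared by \<open>max z 0\<close> and \<open>ln (exp z + 1)\<close> from which the behaviour of
  \<open>t \<mapsto> expectation (h (t + Z))\<close> follows. Strictness is asked for only on the positive axis, because
  the positive part is constant on the negative one; the linear upper bound makes \<open>h (t + Z)\<close>
  integrable whenever \<open>Z\<close> is.
\<close>

locale soft_positive_part =
  fixes h :: "real \<Rightarrow> real" and K :: real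
  assumes mono: "mono h"
    and strict_mono: "strict_mono_on {0..} h"
    and lim_at_bot: "(h \<longlongrightarrow> 0) at_bot"
    and lower: "z \<le> h z"
    and upper: "h z \<le> K + \<bar>z\<bar>"
    and nonneg: "0 \<le> h z"
begin

lemma measurable[measurable]: "h \<in> borel_measurable borel"
  by (rule borel_measurable_mono[OF mono])

context
  fixes M :: "'a measure" and Z :: "'a \<Rightarrow> real"
  assumes M: "prob_space M" and Z: "integrable M Z"
begin

interpretation prob_space M by (rule M)

lemma integrable_shift: "integrable M (\<lambda>x. h (t + Z x))"
proof (rule Bochner_Integration.integrable_bound)
  show "integrable M (\<lambda>x. K + \<bar>t + Z x\<bar>)"
    by (auto intro!: Bochner_Integration.integrable_add Z integrable_abs)
  note [measurable] = borel_measurable_integrable[OF Z]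
  show "(\<lambda>x. h (t + Z x)) \<in> borel_measurable M" by measurable
  show "AE x in M. norm (h (t + Z x)) \<le> norm (K + \<bar>t + Z x\<bar>)"
    using nonneg upper by (intro AE_I2) (auto intro: order_trans[OF _ abs_ge_self])
qed

text \<open>
  Raising the shift increases \<open>h (t + Z)\<close> weakly everywhere, and strictly on the event that the argument
  was already positive; that event has positive probability because \<open>Z\<close> is unbounded above.
\<close>

lemma expectation_shift_strict_mono:
  assumes unbounded: "\<And>c. 0 < prob {x \<in> space M. c < Z x}"
  shows "strict_mono (\<lambda>t. expectation (\<lambda>x. h (t + Z x)))"
proof (rule strict_monoI)
  fix s t :: real assume "s < t"
  note [measurable] = borel_measurable_integrable[OF Z]
  show "expectation (\<lambda>x. h (s + Z x)) < expectation (\<lambda>x. h (t + Z x))"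
  proof (rule integral_less_AE[OF integrable_shift integrable_shift])
    show "emeasure M {x \<in> space M. - s < Z x} \<noteq> 0"
      using unbounded[of "- s"] by (simp add: measure_def) (metis enn2real_0 less_irrefl)
    show "{x \<in> space M. - s < Z x} \<in> sets M" by measurable
    have "h (s + Z x) < h (t + Z x)" if "- s < Z x" for x
      using strict_mono_onD[OF strict_mono, of "s + Z x" "t + Z x"] that \<open>s < t\<close> by simp
    then show "AE x in M. x \<in> {x \<in> space M. - s < Z x} \<longrightarrow> h (s + Z x) \<noteq> h (t + Z x)"
      by (intro AE_I2) (auto simp: less_le)
    show "AE x in M. h (s + Z x) \<le> h (t + Z x)"
      using \<open>s < t\<close> by (intro AE_I2 monoD[OF mono]) auto
  qed
qed

text \<open>
  By monotonicity the integrands with negative shift are dominated by the one with shift \<open>0\<close>.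
\<close>

lemma expectation_shift_at_bot: "((\<lambda>t. expectation (\<lambda>x. h (t + Z x))) \<longlongrightarrow> 0) at_bot"
proof -
  note [measurable] = borel_measurable_integrable[OF Z]
  have "((\<lambda>t. expectation (\<lambda>x. h (- t + Z x))) \<longlongrightarrow> expectation (\<lambda>x. 0)) at_top"
  proof (rule integral_dominated_convergence_at_top)
    show "integrable M (\<lambda>x. h (0 + Z x))" by (rule integrable_shift)
    show "\<forall>\<^sub>F t in at_top. AE x in M. norm (h (- t + Z x)) \<le> h (0 + Z x)"
      using eventually_ge_at_top[of 0]
    proof eventually_elim
      case (elim t)
      then have "h (- t + Z x) \<le> h (0 + Z x)" for x by (intro monoD[OF mono]) simp
      with nonneg show ?case by (intro AE_I2) simp
    qed
    show "AE x in M. ((\<lambda>t. h (- t + Z x)) \<longlongrightarrow> 0) at_top"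
    proof (intro AE_I2 filterlim_compose[OF lim_at_bot])
      fix x show "LIM t at_top. - t + Z x :> at_bot"
        using filterlim_tendsto_add_at_top[OF tendsto_const[of "- Z x"] filterlim_ident[of at_top]]
        by (simp add: filterlim_uminus_at_bot add.commute)
    qed
  qed simp_all
  then show ?thesis by (simp add: filterlim_at_bot_mirror)
qed

lemma expectation_shift_at_top: "filterlim (\<lambda>t. expectation (\<lambda>x. h (t + Z x))) at_top at_top"
proof (rule filterlim_at_top_mono)
  show "LIM t at_top. expectation Z + t :> at_top"
    by (rule filterlim_tendsto_add_at_top[OF tendsto_const filterlim_ident])
  have "expectation Z + t \<le> expectation (\<lambda>x. h (t + Z x))" for t
  proof -
    have "expectation Z + t = expectation (\<lambda>x. t + Z x)"
      using Z by (simp add: prob_space)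
    also have "\<dots> \<le> expectation (\<lambda>x. h (t + Z x))"
      using Z lower by (intro integral_mono integrable_shift) auto
    finally show ?thesis .
  qed
  then show "\<forall>\<^sub>F t in at_top. expectation Z + t \<le> expectation (\<lambda>x. h (t + Z x))" by simp
qed

end

end

section \<open>The incomplete Gauss integral and the Gamma distribution of shape one half\<close>

definition gauss_integral :: "real \<Rightarrow> real" where
  "gauss_integral b = (LBINT x:{0..b}. exp (- x\<^sup>2))"

lemma gauss_set_integrable: "set_integrable lborel {a..b} (\<lambda>x::real. exp (- x\<^sup>2))"
  by (intro borel_integrable_atLeastAtMost') (auto intro!: continuous_intros)

lemma gauss_integral_eq_integral: "gauss_integral b = integral {0..b} (\<lambda>x. exp (- x\<^sup>2))"
  unfolding gauss_integral_def by (rule set_borel_integral_eq_integral[OF gauss_set_integrable])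

lemma gauss_integral_strict_mono: "strict_mono_on {0..} gauss_integral"
proof (rule strict_mono_onI)
  fix a b :: real assume "a \<in> {0..}" "b \<in> {0..}" "a < b"
  then have ab: "0 \<le> a" "a < b" by auto
  let ?f = "\<lambda>x::real. exp (- x\<^sup>2)"
  have int: "?f integrable_on {u..v}" for u v
    by (intro integrable_continuous_real continuous_intros)
  have "0 < (b - a) * exp (- b\<^sup>2)"
    using ab by simp
  also have "\<dots> = integral {a..b} (\<lambda>_. exp (- b\<^sup>2))"
    using ab by simp
  also have "\<dots> \<le> integral {a..b} ?f"
    using ab by (intro integral_le int) (auto intro!: power_mono)
  finally show "gauss_integral a < gauss_integral b"
    using Henstock_Kurzweil_Integration.integral_combine[of 0 a b ?f] ab int
    by (simp add: gauss_integral_eq_integral)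
qed

lemma gauss_integral_continuous: "continuous_on {0..b} gauss_integral"
  unfolding gauss_integral_eq_integral
  by (intro indefinite_integral_continuous_1 integrable_continuous_real continuous_intros)

lemma set_integral_mono_subset:
  fixes f :: "real \<Rightarrow> real"
  assumes "set_integrable lborel B f" "A \<in> sets lborel" "A \<subseteq> B" "\<And>x. x \<in> B \<Longrightarrow> 0 \<le> f x"
  shows "(LBINT x:A. f x) \<le> (LBINT x:B. f x)"
  using assms set_integrable_subset[OF assms(1-3)] unfolding set_lebesgue_integral_def set_integrable_def
  by (intro integral_mono) (auto split: split_indicator)

text \<open>
  The bound is the integral over the whole half-line; it is not attained because the integral over
  \<open>{0..b}\<close> still grows beyond \<open>b\<close>.
\<close>

lemma gauss_integral_less: "gauss_integral b < sqrt pi / 2"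
proof -
  have "gauss_integral b \<le> gauss_integral \<bar>b\<bar>"
    unfolding gauss_integral_def
    by (intro set_integral_mono_subset gauss_set_integrable) auto
  also have "\<dots> < gauss_integral (\<bar>b\<bar> + 1)"
    by (intro strict_mono_onD[OF gauss_integral_strict_mono]) auto
  also have "\<dots> \<le> (LBINT x:{0..}. exp (- x\<^sup>2))"
    unfolding gauss_integral_def
    using gaussian_moment_0
    by (intro set_integral_mono_subset) (auto simp: set_integrable_def has_bochner_integral_iff)
  also have "\<dots> = sqrt pi / 2"
    using gaussian_moment_0 by (simp add: set_lebesgue_integral_def has_bochner_integral_iff)
  finally show ?thesis .
qed

text \<open>This is Euler's integral for \<open>Gamma (1 / 2)\<close>.\<close>

lemma gamma_density_has_integral:
  "has_bochner_integral lborel (\<lambda>z. indicator {0..} z *\<^sub>R (exp (- z) / sqrt z)) (sqrt pi)"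
proof (rule has_bochner_integral_nn_integral)
  have "(\<integral>\<^sup>+z. ennreal (indicator {0..} z *\<^sub>R (exp (- z) / sqrt z)) \<partial>lborel)
      = (\<integral>\<^sup>+z. ennreal (indicator {0..} z * z powr (1 / 2 - 1) / exp z) \<partial>lborel)"
    by (intro nn_integral_cong)
      (auto split: split_indicator simp: powr_minus powr_half_sqrt exp_minus divide_simps mult.commute)
  also have "\<dots> = ennreal (sqrt pi)"
    using Gamma_conv_nn_integral_real[of "1/2"] by (simp add: Gamma_one_half_real)
  finally show "(\<integral>\<^sup>+z. ennreal (indicator {0..} z *\<^sub>R (exp (- z) / sqrt z)) \<partial>lborel) = ennreal (sqrt pi)" .
qed (auto split: split_indicator intro!: AE_I2)

lemma gamma_density_set_integrable:
  "S \<in> sets lborel \<Longrightarrow> S \<subseteq> {0..} \<Longrightarrow> set_integrable lborel S (\<lambda>z::real. exp (- z) / sqrt z)"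
  by (rule set_integrable_subset[of lborel "{0..}"])
    (use gamma_density_has_integral in \<open>auto simp: set_integrable_def has_bochner_integral_iff\<close>)

text \<open>
  Substitute \<open>z = x\<^sup>2\<close>: the factor \<open>2 * x\<close> cancels the singularity of \<open>1 / sqrt z\<close>.
\<close>

lemma lower_gamma_integral:
  assumes "0 \<le> a"
  shows "(LBINT z:{0..a}. exp (- z) / sqrt z) = 2 * gauss_integral (sqrt a)"
proof -
  have "(LBINT z:{0..a}. exp (- z) / sqrt z)
      = (LBINT z. exp (- z) / sqrt z * indicator {0\<^sup>2..(sqrt a)\<^sup>2} z)"
    using assms by (simp add: set_lebesgue_integral_def mult.commute)
  also have "\<dots> = (LBINT x. exp (- x\<^sup>2) / sqrt (x\<^sup>2) * (2 * x) * indicator {0..sqrt a} x)"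
    using assms
    by (intro integral_substitution(2)[where g = "\<lambda>x. x\<^sup>2"] gamma_density_set_integrable)
      (auto intro!: derivative_eq_intros continuous_intros)
  also have "\<dots> = (LBINT x. 2 * (indicator {0..sqrt a} x * exp (- x\<^sup>2)))"
  proof (rule integral_cong_AE)
    \<comment> \<open>At \<open>x = 0\<close> the left integrand is \<open>0\<close>, since division by zero yields \<open>0\<close>, and the right one is \<open>2\<close>.\<close>
    show "AE x in lborel. exp (- x\<^sup>2) / sqrt (x\<^sup>2) * (2 * x) * indicator {0..sqrt a} x
        = 2 * (indicator {0..sqrt a} x * exp (- x\<^sup>2))"
      using AE_lborel_singleton[of 0] by eventually_elim (auto split: split_indicator)
  qed measurable
  finally show ?thesis
    by (simp add: gauss_integral_def set_lebesgue_integral_def)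
qed

lemma upper_gamma_integral:
  assumes "0 \<le> a"
  shows "(LBINT z:{a..}. exp (- z) / sqrt z) = sqrt pi - 2 * gauss_integral (sqrt a)"
proof -
  have "(LBINT z:{0..a} \<union> {a..}. exp (- z) / sqrt z)
      = (LBINT z:{0..a}. exp (- z) / sqrt z) + (LBINT z:{a..}. exp (- z) / sqrt z)"
    using assms
  proof (intro set_integral_Un_AE gamma_density_set_integrable)
    show "AE z in lborel. \<not> (z \<in> {0..a} \<and> z \<in> {a..})"
      by (rule AE_I[where N = "{a}"]) auto
  qed auto
  moreover have "{0..a} \<union> {a..} = {0..}"
    using assms by auto
  moreover have "(LBINT z:{0..}. exp (- z) / sqrt z) = sqrt pi"
    using gamma_density_has_integral by (simp add: set_lebesgue_integral_def has_bochner_integral_iff)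
  ultimately show ?thesis
    using lower_gamma_integral[OF assms] by simp
qed

section \<open>Numerical enclosure of the turning point\<close>

text \<open>
  In the Lagrange remainder of the exponential series at \<open>- u\<close> only the factor \<open>(- u) ^ n\<close> has a sign
  that varies, so the parity of \<open>n\<close> decides on which side the Taylor polynomial lies.
\<close>

lemma exp_minus_le_Taylor:
  fixes u :: real
  assumes "0 \<le> u" "odd n"
  shows "exp (- u) \<le> (\<Sum>k<n. (- u) ^ k / fact k)"
proof -
  obtain t where t: "exp (- u) = (\<Sum>k<n. (- u) ^ k / fact k) + exp t / fact n * (- u) ^ n"
    using Maclaurin_exp_le[of "- u" n] by blast
  have "(- u) ^ n \<le> 0"
    using assms by simp
  then have "exp t / fact n * (- u) ^ n \<le> 0"
    by (intro mult_nonneg_nonpos) auto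
  with t show ?thesis by simp
qed

lemma exp_minus_ge_Taylor:
  fixes u :: real
  assumes "even n"
  shows "(\<Sum>k<n. (- u) ^ k / fact k) \<le> exp (- u)"
proof -
  obtain t where t: "exp (- u) = (\<Sum>k<n. (- u) ^ k / fact k) + exp t / fact n * (- u) ^ n"
    using Maclaurin_exp_le[of "- u" n] by blast
  have "0 \<le> exp t / fact n * (- u) ^ n"
    using zero_le_even_power[OF assms, of "- u"] by (intro mult_nonneg_nonneg) auto
  with t show ?thesis by simp
qed

lemma Taylor_gauss_integral:
  assumes "0 \<le> b"
  shows "set_integrable lborel {0..b} (\<lambda>x::real. \<Sum>k<n. (- x\<^sup>2) ^ k / fact k)"
    and "(LBINT x:{0..b}. \<Sum>k<n. (- x\<^sup>2) ^ k / fact k)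
      = (\<Sum>k<n. (-1) ^ k * b ^ (2 * k + 1) / (fact k * real (2 * k + 1)))"
proof -
  show "set_integrable lborel {0..b} (\<lambda>x::real. \<Sum>k<n. (- x\<^sup>2) ^ k / fact k)"
    by (intro borel_integrable_atLeastAtMost') (auto intro!: continuous_intros)
  let ?F = "\<lambda>x::real. \<Sum>k<n. (-1) ^ k * x ^ (2 * k + 1) / (fact k * real (2 * k + 1))"
  have "(LBINT x. (\<Sum>k<n. (- x\<^sup>2) ^ k / fact k) * indicator {0..b} x) = ?F b - ?F 0"
  proof (rule integral_FTC_Icc_real)
    fix x :: real
    have summand: "((\<lambda>x. (-1) ^ k * x ^ (2 * k + 1) / (fact k * real (2 * k + 1)))
        has_real_derivative (- x\<^sup>2) ^ k / fact k) (at x)" for k :: nat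
    proof -
      have "((\<lambda>x. (-1) ^ k * x ^ (2 * k + 1) / (fact k * real (2 * k + 1)))
          has_real_derivative
          (-1) ^ k * (real (2 * k + 1) * x ^ (2 * k)) / (fact k * real (2 * k + 1))) (at x)"
        by (intro DERIV_cdivide DERIV_cmult) (use DERIV_pow[of "2 * k + 1" x] in simp)
      also have "(-1) ^ k * (real (2 * k + 1) * x ^ (2 * k)) / (fact k * real (2 * k + 1))
          = (-1) ^ k * x ^ (2 * k) / fact k"
        by (simp del: of_nat_add of_nat_Suc of_nat_mult)
      also have "(-1) ^ k * x ^ (2 * k) = (- x\<^sup>2) ^ k"
        by (simp add: power_minus[of "x\<^sup>2"] power_mult)
      finally show ?thesis .
    qed
    show "(?F has_real_derivative (\<Sum>k<n. (- x\<^sup>2) ^ k / fact k)) (at x)"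
      by (intro DERIV_sum summand)
  qed (use assms in \<open>auto intro!: continuous_intros\<close>)
  then show "(LBINT x:{0..b}. \<Sum>k<n. (- x\<^sup>2) ^ k / fact k) = ?F b"
    by (simp add: set_lebesgue_integral_def mult.commute)
qed

lemma gauss_integral_upper:
  assumes "0 \<le> b" "odd n"
  shows "gauss_integral b \<le> (\<Sum>k<n. (-1) ^ k * b ^ (2 * k + 1) / (fact k * real (2 * k + 1)))"
  using set_integral_mono[OF gauss_set_integrable Taylor_gauss_integral(1)[OF assms(1), of n]]
    exp_minus_le_Taylor[OF _ assms(2)] Taylor_gauss_integral(2)[OF assms(1), of n]
  by (simp add: gauss_integral_def)

lemma gauss_integral_lower:
  assumes "0 \<le> b" "even n"
  shows "(\<Sum>k<n. (-1) ^ k * b ^ (2 * k + 1) / (fact k * real (2 * k + 1))) \<le> gauss_integral b"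
  using set_integral_mono[OF Taylor_gauss_integral(1)[OF assms(1), of n] gauss_set_integrable]
    exp_minus_ge_Taylor[OF assms(2)] Taylor_gauss_integral(2)[OF assms(1), of n]
  by (simp add: gauss_integral_def)

lemma sqrt_pi_bounds: "1.77245385 \<le> sqrt pi" "sqrt pi \<le> 1.77245386"
  using pi_approx by (intro real_le_rsqrt real_le_lsqrt; simp add: power2_eq_square)+

lemma sqrt_two_pi_bounds: "2.50662827 \<le> sqrt (2 * pi)" "sqrt (2 * pi) \<le> 2.50662828"
  using pi_approx by (intro real_le_rsqrt real_le_lsqrt; simp add: power2_eq_square)+

text \<open>
  The solution of \<open>gauss_integral q = sqrt pi / 4\<close> is \<open>q = 0.47693627...\<close>, and the turning point
  \<open>exp (- q\<^sup>2) / sqrt (2 * pi) = 0.31777657...\<close> lies only \<open>7.3e-8\<close> above the smallest admissible value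
  \<open>0.3177765\<close>. As the turning point decreases in \<open>q\<close> with slope about \<open>-0.3\<close>, the upper bound for \<open>q\<close> has
  to be sharp to about \<open>2e-7\<close>, while the lower bound may be off by \<open>3e-6\<close>. At these arguments
  seven or eight terms of the series leave errors below \<open>1e-8\<close>.
\<close>

lemma gauss_integral_quartile_lower: "gauss_integral 0.476935 < sqrt pi / 4"
proof -
  have "gauss_integral 0.476935
      \<le> (\<Sum>k<7. (-1) ^ k * 0.476935 ^ (2 * k + 1) / (fact k * real (2 * k + 1)))"
    by (rule gauss_integral_upper) auto
  also have "\<dots> < 1.77245385 / 4"
    by (simp add: eval_nat_numeral fact_numeral)
  also have "\<dots> \<le> sqrt pi / 4"
    using sqrt_pi_bounds by simp
  finally show ?thesis .
qed

lemma gauss_integral_quartile_upper: "sqrt pi / 4 < gauss_integral 0.4769364"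
proof -
  have "sqrt pi / 4 \<le> 1.77245386 / 4"
    using sqrt_pi_bounds by simp
  also have "\<dots> < (\<Sum>k<8. (-1) ^ k * 0.4769364 ^ (2 * k + 1) / (fact k * real (2 * k + 1)))"
    by (simp add: eval_nat_numeral fact_numeral)
  also have "\<dots> \<le> gauss_integral 0.4769364"
    by (rule gauss_integral_lower) auto
  finally show ?thesis .
qed

lemma gauss_integral_quartile:
  obtains q where "0.476935 \<le> q" "q \<le> 0.4769364"
    "\<And>b. 0 \<le> b \<Longrightarrow> gauss_integral b = sqrt pi / 4 \<longleftrightarrow> b = q"
proof -
  have "\<exists>q. 0.476935 \<le> q \<and> q \<le> 0.4769364 \<and> gauss_integral q = sqrt pi / 4"
    using gauss_integral_quartile_lower gauss_integral_quartile_upper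
    by (intro IVT') (auto intro: continuous_on_subset[OF gauss_integral_continuous[of "0.4769364"]])
  then obtain q where q: "0.476935 \<le> q" "q \<le> 0.4769364" "gauss_integral q = sqrt pi / 4"
    by blast
  have "gauss_integral b = sqrt pi / 4 \<longleftrightarrow> b = q" if "0 \<le> b" for b
    using strict_mono_on_eqD[OF gauss_integral_strict_mono, of q b] q that by auto
  with q that show thesis by blast
qed

lemma critical_deviation_bounds:
  assumes "0.476935 \<le> q" "q \<le> 0.4769364"
  shows "\<bar>exp (- q\<^sup>2) / sqrt (2 * pi) - 0.317777\<bar> \<le> 0.0000005"
proof -
  have "exp (- q\<^sup>2) \<le> exp (- 0.476935\<^sup>2)"
    using assms by (simp add: power_mono)
  also have "\<dots> \<le> (\<Sum>k<7. (- 0.476935\<^sup>2) ^ k / fact k)"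
    by (rule exp_minus_le_Taylor) auto
  also have "\<dots> \<le> 0.3177775 * 2.50662827"
    by (simp add: eval_nat_numeral fact_numeral)
  also have "\<dots> \<le> 0.3177775 * sqrt (2 * pi)"
    using sqrt_two_pi_bounds by simp
  finally have upper: "exp (- q\<^sup>2) / sqrt (2 * pi) \<le> 0.3177775"
    by (simp add: divide_le_eq)
  have "0.3177765 * sqrt (2 * pi) \<le> 0.3177765 * 2.50662828"
    using sqrt_two_pi_bounds by simp
  also have "\<dots> \<le> (\<Sum>k<8. (- 0.4769364\<^sup>2) ^ k / fact k)"
    by (simp add: eval_nat_numeral fact_numeral)
  also have "\<dots> \<le> exp (- 0.4769364\<^sup>2)"
    by (rule exp_minus_ge_Taylor) auto
  also have "\<dots> \<le> exp (- q\<^sup>2)"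
    using assms by (simp add: power_mono)
  finally have "0.3177765 \<le> exp (- q\<^sup>2) / sqrt (2 * pi)"
    by (simp add: le_divide_eq)
  moreover have "\<bar>r - 0.317777\<bar> \<le> 0.0000005" if "r \<le> 0.3177775" "0.3177765 \<le> r" for r :: real
    using that by (intro abs_leI; simp)
  ultimately show ?thesis using upper by blast
qed

section \<open>The Gaussian entropies as expectations of half a squared standard normal variable\<close>

abbreviation std_normal :: "real measure" where
  "std_normal \<equiv> density lborel (\<lambda>x. ennreal (std_normal_density x))"

interpretation std_normal: prob_space std_normal
  by (rule prob_space_normal_density) simp

lemma half_square_moment:
  "integrable std_normal (\<lambda>y. y\<^sup>2 / 2)" "std_normal.expectation (\<lambda>y. y\<^sup>2 / 2) = 1 / 2"
  using std_normal_moment_even[of 1]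
  by (auto simp: integrable_density integral_density has_bochner_integral_iff numeral_2_eq_2)

text \<open>
  Substitute \<open>y = sqrt 2 * u\<close> and fold the resulting even integrand onto the positive half-line.
\<close>

lemma half_square_cdf:
  assumes "0 \<le> a"
  shows "std_normal.prob {y \<in> space std_normal. y\<^sup>2 / 2 \<le> a} = 2 / sqrt pi * gauss_integral (sqrt a)"
proof -
  let ?f = "\<lambda>u::real. indicator {u. u\<^sup>2 \<le> a} u * exp (- u\<^sup>2)"
  have le_sqrt: "u \<le> sqrt a \<longleftrightarrow> u\<^sup>2 \<le> a" if "0 \<le> u" for u
    using that real_sqrt_le_iff[of "u\<^sup>2" a] by simp
  have restrict: "indicator {0..} u *\<^sub>R ?f u = indicator {0..sqrt a} u *\<^sub>R exp (- u\<^sup>2)" for u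
    using le_sqrt[of u] by (auto simp: indicator_def)
  have "has_bochner_integral lborel (\<lambda>u. indicator {0..} u *\<^sub>R ?f u) (gauss_integral (sqrt a))"
    using gauss_set_integrable[of 0 "sqrt a"]
    unfolding gauss_integral_def set_integrable_def set_lebesgue_integral_def restrict
    by (simp add: has_bochner_integral_iff)
  then have even: "has_bochner_integral lborel ?f (2 * gauss_integral (sqrt a))"
    using has_bochner_integral_even_function[of ?f] by (simp add: indicator_def)
  have "std_normal.prob {y \<in> space std_normal. y\<^sup>2 / 2 \<le> a}
      = std_normal.expectation (indicator {y. y\<^sup>2 / 2 \<le> a})"
    by simp
  also have "\<dots> = (LBINT y. std_normal_density y * indicator {y. y\<^sup>2 / 2 \<le> a} y)"
    by (subst integral_density) auto
  also have "\<dots> = (LBINT u. sqrt 2 * (std_normal_density (sqrt 2 * u) * indicator {y. y\<^sup>2 / 2 \<le> a} (sqrt 2 * u)))"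
    using lborel_integral_real_affine[of "sqrt 2"
      "\<lambda>y. std_normal_density y * indicator {y. y\<^sup>2 / 2 \<le> a} y" 0] by simp
  also have "\<dots> = (LBINT u. 1 / sqrt pi * ?f u)"
    by (intro Bochner_Integration.integral_cong)
      (auto simp: std_normal_density_def real_sqrt_mult power_mult_distrib indicator_def)
  also have "\<dots> = 2 / sqrt pi * gauss_integral (sqrt a)"
    using even by (simp add: has_bochner_integral_iff)
  finally show ?thesis .
qed

lemma half_square_unbounded: "0 < std_normal.prob {y \<in> space std_normal. c < y\<^sup>2 / 2}"
proof -
  have "{y \<in> space std_normal. y\<^sup>2 / 2 \<le> c} \<subseteq> {y \<in> space std_normal. y\<^sup>2 / 2 \<le> \<bar>c\<bar>}"
    by auto
  then have "std_normal.prob {y \<in> space std_normal. y\<^sup>2 / 2 \<le> c}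
      \<le> std_normal.prob {y \<in> space std_normal. y\<^sup>2 / 2 \<le> \<bar>c\<bar>}"
    by (intro std_normal.finite_measure_mono) auto
  also have "\<dots> < 1"
    using gauss_integral_less[of "sqrt \<bar>c\<bar>"] by (subst half_square_cdf) (auto simp: field_simps)
  finally show ?thesis
    using std_normal.prob_neg[of "\<lambda>y. c < y\<^sup>2 / 2"] by (simp add: not_less)
qed

lemma normal_density_scaled:
  assumes "0 < \<sigma>"
  shows "\<sigma> * normal_density 0 \<sigma> (\<sigma> * y) = std_normal_density y"
    and "- ln (normal_density 0 \<sigma> (\<sigma> * y)) = ln (\<sigma> * sqrt (2 * pi)) + y\<^sup>2 / 2"
proof -
  have p: "normal_density 0 \<sigma> (\<sigma> * y) = exp (- (y\<^sup>2 / 2)) / (\<sigma> * sqrt (2 * pi))"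
    using assms by (simp add: centered_normal_density_eq power_mult_distrib)
  show "\<sigma> * normal_density 0 \<sigma> (\<sigma> * y) = std_normal_density y"
    using assms by (simp add: p std_normal_density_def)
  show "- ln (normal_density 0 \<sigma> (\<sigma> * y)) = ln (\<sigma> * sqrt (2 * pi)) + y\<^sup>2 / 2"
    unfolding p using assms by (subst ln_div) auto
qed

lemma normal_entropy_eq_expectation:
  fixes h :: "real \<Rightarrow> real"
  assumes "0 < \<sigma>" and h[measurable]: "h \<in> borel_measurable borel"
  shows "(LBINT x. normal_density 0 \<sigma> x * h (- ln (normal_density 0 \<sigma> x)))
    = std_normal.expectation (\<lambda>y. h (ln (\<sigma> * sqrt (2 * pi)) + y\<^sup>2 / 2))"
proof -
  have "(LBINT x. normal_density 0 \<sigma> x * h (- ln (normal_density 0 \<sigma> x)))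
      = (LBINT y. \<sigma> * (normal_density 0 \<sigma> (\<sigma> * y) * h (- ln (normal_density 0 \<sigma> (\<sigma> * y)))))"
    using lborel_integral_real_affine[of \<sigma>
      "\<lambda>x. normal_density 0 \<sigma> x * h (- ln (normal_density 0 \<sigma> x))" 0] assms by simp
  also have "\<dots> = (LBINT y. std_normal_density y * h (ln (\<sigma> * sqrt (2 * pi)) + y\<^sup>2 / 2))"
    using normal_density_scaled[OF assms(1)] by (simp add: mult.assoc[symmetric])
  also have "\<dots> = std_normal.expectation (\<lambda>y. h (ln (\<sigma> * sqrt (2 * pi)) + y\<^sup>2 / 2))"
    by (subst integral_density) auto
  finally show ?thesis .
qed

lemma shannon_alt1_normal:
  assumes "0 < \<sigma>"
  shows "shannon_alt1 (normal_density 0 \<sigma>)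
    = std_normal.expectation (\<lambda>y. \<bar>ln (\<sigma> * sqrt (2 * pi)) + y\<^sup>2 / 2\<bar>)"
  using normal_entropy_eq_expectation[OF assms, of abs] by (simp add: shannon_alt1_def)

lemma shannon_alt2_normal:
  assumes "0 < \<sigma>"
  shows "shannon_alt2 (normal_density 0 \<sigma>)
    = std_normal.expectation (\<lambda>y. max (ln (\<sigma> * sqrt (2 * pi)) + y\<^sup>2 / 2) 0)"
  using normal_entropy_eq_expectation[OF assms, of "\<lambda>z. max z 0"] by (simp add: shannon_alt2_def)

lemma shannon_alt3_normal:
  assumes "0 < \<sigma>"
  shows "shannon_alt3 (normal_density 0 \<sigma>)
    = std_normal.expectation (\<lambda>y. ln (exp (ln (\<sigma> * sqrt (2 * pi)) + y\<^sup>2 / 2) + 1))"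
proof -
  have "inverse (normal_density 0 \<sigma> x) = exp (- ln (normal_density 0 \<sigma> x))" for x
    using assms by (simp add: exp_minus normal_density_pos)
  then show ?thesis
    using normal_entropy_eq_expectation[OF assms, of "\<lambda>z. ln (exp z + 1)"]
    by (simp add: shannon_alt3_def del: exp_minus)
qed

text \<open>
  With \<open>c = \<sigma> * sqrt (2 * pi)\<close> the density has maximum \<open>1 / c\<close>, attained at \<open>0\<close>. The integrand is
  therefore \<open>c\<close> times the density times \<open>h (- ln p)\<close> for \<open>h z = z - ln c\<close>, and this \<open>h\<close> removes the
  shift \<open>ln c\<close>: what remains is \<open>c\<close> times the mean of \<open>y\<^sup>2 / 2\<close>.
\<close>

lemma shannon_alt4_normal:
  assumes "0 < \<sigma>"
  shows "shannon_alt4 (normal_density 0 \<sigma>) = \<sigma> * sqrt (2 * pi) / 2"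
proof -
  define c where "c = \<sigma> * sqrt (2 * pi)"
  have "0 < c"
    using assms by (simp add: c_def)
  have sup: "(SUP x. normal_density 0 \<sigma> x) = 1 / c"
  proof (rule cSup_eq_maximum)
    show "1 / c \<in> range (normal_density 0 \<sigma>)"
      using assms by (auto simp: c_def centered_normal_density_eq intro!: image_eqI[of _ _ 0])
    show "y \<le> 1 / c" if "y \<in> range (normal_density 0 \<sigma>)" for y
      using that assms \<open>0 < c\<close>
      by (auto simp: c_def[symmetric] centered_normal_density_eq intro!: divide_right_mono)
  qed
  have integrand: "normal_density 0 \<sigma> x / (1 / c) * ln (1 / c / normal_density 0 \<sigma> x)
      = c * (normal_density 0 \<sigma> x * (- ln c + - ln (normal_density 0 \<sigma> x)))" for x
    using normal_density_pos[OF assms, of 0 x] \<open>0 < c\<close> by (simp add: ln_div ln_mult)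
  have "shannon_alt4 (normal_density 0 \<sigma>)
      = c * (LBINT x. normal_density 0 \<sigma> x * (- ln c + - ln (normal_density 0 \<sigma> x)))"
    unfolding shannon_alt4_def sup Let_def integrand by simp
  also have "\<dots> = c * std_normal.expectation (\<lambda>y. y\<^sup>2 / 2)"
    by (subst normal_entropy_eq_expectation[OF assms, of "\<lambda>z. - ln c + z"])
      (simp_all add: c_def[symmetric])
  finally show ?thesis
    using half_square_moment by (simp add: c_def)
qed

section \<open>Monotonicity and limits of the Gaussian entropies\<close>

lemma ln_scale_at_top: "filterlim (\<lambda>\<sigma>. ln (\<sigma> * sqrt (2 * pi))) at_top at_top"
  by real_asymp

lemma ln_scale_at_right_0: "filterlim (\<lambda>\<sigma>. ln (\<sigma> * sqrt (2 * pi))) at_bot (at_right 0)"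
  by real_asymp

lemma (in soft_positive_part) normal_entropy_monotone_limits:
  fixes H :: "(real \<Rightarrow> real) \<Rightarrow> real"
  assumes H: "\<And>\<sigma>. 0 < \<sigma> \<Longrightarrow> H (normal_density 0 \<sigma>)
    = std_normal.expectation (\<lambda>y. h (ln (\<sigma> * sqrt (2 * pi)) + y\<^sup>2 / 2))"
  shows "strict_mono_on {0<..} (\<lambda>\<sigma>. H (normal_density 0 \<sigma>))"
    and "((\<lambda>\<sigma>. H (normal_density 0 \<sigma>)) \<longlongrightarrow> 0) (at_right 0)"
    and "filterlim (\<lambda>\<sigma>. H (normal_density 0 \<sigma>)) at_top at_top"
proof -
  note shift = std_normal.prob_space_axioms half_square_moment(1)
  let ?E = "\<lambda>t. std_normal.expectation (\<lambda>y. h (t + y\<^sup>2 / 2))"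
  show "strict_mono_on {0<..} (\<lambda>\<sigma>. H (normal_density 0 \<sigma>))"
  proof (rule strict_mono_onI)
    fix r s :: real assume "r \<in> {0<..}" "s \<in> {0<..}" "r < s"
    then show "H (normal_density 0 r) < H (normal_density 0 s)"
      using strict_monoD[OF expectation_shift_strict_mono[OF shift half_square_unbounded]]
      by (simp add: H)
  qed
  have "((\<lambda>\<sigma>. ?E (ln (\<sigma> * sqrt (2 * pi)))) \<longlongrightarrow> 0) (at_right 0)"
    by (rule filterlim_compose[OF expectation_shift_at_bot[OF shift] ln_scale_at_right_0])
  then show "((\<lambda>\<sigma>. H (normal_density 0 \<sigma>)) \<longlongrightarrow> 0) (at_right 0)"
    by (rule Lim_transform_eventually)
      (auto simp: H intro: eventually_mono[OF eventually_at_right_less])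
  have "filterlim (\<lambda>\<sigma>. ?E (ln (\<sigma> * sqrt (2 * pi)))) at_top at_top"
    by (rule filterlim_compose[OF expectation_shift_at_top[OF shift] ln_scale_at_top])
  then show "filterlim (\<lambda>\<sigma>. H (normal_density 0 \<sigma>)) at_top at_top"
    by (rule filterlim_mono_eventually)
      (auto simp: H intro: eventually_mono[OF eventually_gt_at_top[of 0]])
qed

interpretation positive_part: soft_positive_part "\<lambda>z. max z 0" 0
proof
  show "strict_mono_on {0..} (\<lambda>z::real. max z 0)"
    by (rule strict_mono_onI) auto
  show "((\<lambda>z::real. max z 0) \<longlongrightarrow> 0) at_bot"
    by (rule tendsto_eventually) (auto intro: eventually_mono[OF eventually_le_at_bot[of 0]])
qed (auto intro!: monoI)

interpretation softplus: soft_positive_part "\<lambda>z. ln (exp z + 1)" "ln 2"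
proof
  show "mono (\<lambda>z::real. ln (exp z + 1))"
    by (rule monoI) (simp add: add_pos_pos)
  show "strict_mono_on {0..} (\<lambda>z::real. ln (exp z + 1))"
    by (rule strict_mono_onI) (simp add: add_pos_pos)
  show "((\<lambda>z::real. ln (exp z + 1)) \<longlongrightarrow> 0) at_bot"
    by real_asymp
  fix z :: real
  show "z \<le> ln (exp z + 1)"
    by (simp add: ln_ge_iff add_pos_pos)
  have "exp z + 1 \<le> 2 * exp \<bar>z\<bar>"
    using exp_le_cancel_iff[of z "\<bar>z\<bar>"] one_le_exp_iff[of "\<bar>z\<bar>"] by linarith
  then have "ln (exp z + 1) \<le> ln (2 * exp \<bar>z\<bar>)"
    by (simp add: add_pos_pos)
  then show "ln (exp z + 1) \<le> ln 2 + \<bar>z\<bar>"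
    by (simp add: ln_mult)
  show "0 \<le> ln (exp z + 1)"
    by (simp add: ln_ge_zero)
qed

lemma shannon_alt4_normal_monotone_limits:
  shows "strict_mono_on {0<..} (\<lambda>\<sigma>. shannon_alt4 (normal_density 0 \<sigma>))"
    and "((\<lambda>\<sigma>. shannon_alt4 (normal_density 0 \<sigma>)) \<longlongrightarrow> 0) (at_right 0)"
    and "filterlim (\<lambda>\<sigma>. shannon_alt4 (normal_density 0 \<sigma>)) at_top at_top"
proof -
  show "strict_mono_on {0<..} (\<lambda>\<sigma>. shannon_alt4 (normal_density 0 \<sigma>))"
    by (rule strict_mono_onI) (simp add: shannon_alt4_normal)
  have "((\<lambda>\<sigma>. \<sigma> * sqrt (2 * pi) / 2) \<longlongrightarrow> 0) (at_right 0)"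
    by real_asymp
  then show "((\<lambda>\<sigma>. shannon_alt4 (normal_density 0 \<sigma>)) \<longlongrightarrow> 0) (at_right 0)"
    by (rule Lim_transform_eventually)
      (auto simp: shannon_alt4_normal intro: eventually_mono[OF eventually_at_right_less])
  have "filterlim (\<lambda>\<sigma>. \<sigma> * sqrt (2 * pi) / 2) at_top at_top"
    by real_asymp
  then show "filterlim (\<lambda>\<sigma>. shannon_alt4 (normal_density 0 \<sigma>)) at_top at_top"
    by (rule filterlim_mono_eventually)
      (auto simp: shannon_alt4_normal intro: eventually_mono[OF eventually_gt_at_top[of 0]])
qed

text \<open>
  The two integrals add up to \<open>sqrt pi\<close>, so they agree exactly if the lower one is \<open>sqrt pi / 2\<close>, that
  is, if the Gauss integral up to \<open>sqrt (- ln (s * sqrt (2 * pi)))\<close> is \<open>sqrt pi / 4\<close>.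
\<close>

lemma gamma_balance_iff:
  assumes q: "0 < q" "\<And>b. 0 \<le> b \<Longrightarrow> gauss_integral b = sqrt pi / 4 \<longleftrightarrow> b = q"
  shows "0 < s \<and> 0 < - ln (s * sqrt (2 * pi)) \<and>
      (LBINT z:{0..- ln (s * sqrt (2 * pi))}. exp (- z) / sqrt z)
        = (LBINT z:{- ln (s * sqrt (2 * pi))..}. exp (- z) / sqrt z)
    \<longleftrightarrow> s = exp (- q\<^sup>2) / sqrt (2 * pi)"
proof -
  define a where "a = - ln (s * sqrt (2 * pi))"
  have "0 < s \<and> 0 < a \<and>
      (LBINT z:{0..a}. exp (- z) / sqrt z) = (LBINT z:{a..}. exp (- z) / sqrt z)
    \<longleftrightarrow> 0 < s \<and> 0 < a \<and> gauss_integral (sqrt a) = sqrt pi / 4"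
    by (auto simp: lower_gamma_integral upper_gamma_integral)
  also have "\<dots> \<longleftrightarrow> 0 < s \<and> 0 < a \<and> sqrt a = q"
    using q(2)[of "sqrt a"] by auto
  also have "\<dots> \<longleftrightarrow> 0 < s \<and> a = q\<^sup>2"
    using \<open>0 < q\<close> by auto
  also have "\<dots> \<longleftrightarrow> s * sqrt (2 * pi) = exp (- q\<^sup>2)"
  proof
    assume "0 < s \<and> a = q\<^sup>2"
    then have "0 < s * sqrt (2 * pi)" "ln (s * sqrt (2 * pi)) = - q\<^sup>2"
      by (auto simp: a_def)
    then show "s * sqrt (2 * pi) = exp (- q\<^sup>2)"
      by (metis exp_ln)
  next
    assume s: "s * sqrt (2 * pi) = exp (- q\<^sup>2)"
    have "0 < s * sqrt (2 * pi)"
      unfolding s by simp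
    then have "0 < s"
      by (simp add: zero_less_mult_iff)
    with s show "0 < s \<and> a = q\<^sup>2"
      by (simp add: a_def)
  qed
  also have "\<dots> \<longleftrightarrow> s = exp (- q\<^sup>2) / sqrt (2 * pi)"
    by (simp add: eq_divide_eq)
  finally show ?thesis unfolding a_def .
qed

text \<open>
  The entropy is the mean deviation of \<open>y\<^sup>2 / 2\<close> from \<open>c \<sigma> = - ln (\<sigma> * sqrt (2 * pi))\<close>. As \<open>\<sigma>\<close> grows,
  \<open>c \<sigma>\<close> decreases and passes the median \<open>q\<^sup>2\<close> at \<open>\<sigma>\<^sub>0\<close>: it approaches the median before \<open>\<sigma>\<^sub>0\<close> and
  moves away from it afterwards.
\<close>

lemma shannon_alt1_normal_monotone:
  assumes q: "0 < q" "gauss_integral q = sqrt pi / 4"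
  defines "\<sigma>\<^sub>0 \<equiv> exp (- q\<^sup>2) / sqrt (2 * pi)"
  shows "strict_antimono_on {0<..<\<sigma>\<^sub>0} (\<lambda>\<sigma>. shannon_alt1 (normal_density 0 \<sigma>))"
    and "strict_mono_on {\<sigma>\<^sub>0<..} (\<lambda>\<sigma>. shannon_alt1 (normal_density 0 \<sigma>))"
proof -
  define c where "c \<sigma> = - ln (\<sigma> * sqrt (2 * pi))" for \<sigma>
  have "0 < \<sigma>\<^sub>0"
    by (simp add: \<sigma>\<^sub>0_def)
  have c0: "c \<sigma>\<^sub>0 = q\<^sup>2"
    by (simp add: c_def \<sigma>\<^sub>0_def)
  have c_less: "c s < c r" if "0 < r" "r < s" for r s
    using that by (simp add: c_def)
  have H1: "shannon_alt1 (normal_density 0 \<sigma>) = std_normal.expectation (\<lambda>y. \<bar>y\<^sup>2 / 2 - c \<sigma>\<bar>)"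
    if "0 < \<sigma>" for \<sigma>
    using that by (simp add: shannon_alt1_normal c_def add.commute)
  note abs_deviation = std_normal.expectation_abs_deviation_less_left[OF half_square_moment(1)]
    std_normal.expectation_abs_deviation_less_right[OF half_square_moment(1)]
  show "strict_antimono_on {0<..<\<sigma>\<^sub>0} (\<lambda>\<sigma>. shannon_alt1 (normal_density 0 \<sigma>))"
  proof (rule monotone_onI)
    fix r s assume rs: "r \<in> {0<..<\<sigma>\<^sub>0}" "s \<in> {0<..<\<sigma>\<^sub>0}" "r < s"
    then have "q\<^sup>2 < c s"
      using c_less[of s \<sigma>\<^sub>0] c0 by auto
    then have "q < sqrt (c s)" and "0 \<le> c s"
      using real_less_rsqrt[of q "c s"] zero_le_power2[of q] by linarith+
    then have "gauss_integral q < gauss_integral (sqrt (c s))"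
      using \<open>0 < q\<close> by (intro strict_mono_onD[OF gauss_integral_strict_mono]) (auto intro: less_imp_le)
    then have "1 / 2 < std_normal.prob {y \<in> space std_normal. y\<^sup>2 / 2 \<le> c s}"
      using \<open>0 \<le> c s\<close> q by (subst half_square_cdf) (auto simp: field_simps)
    then show "shannon_alt1 (normal_density 0 r) > shannon_alt1 (normal_density 0 s)"
      using rs abs_deviation(2)[of "c s" "c r"] c_less[of r s] by (simp add: H1)
  qed
  show "strict_mono_on {\<sigma>\<^sub>0<..} (\<lambda>\<sigma>. shannon_alt1 (normal_density 0 \<sigma>))"
  proof (rule strict_mono_onI)
    fix r s assume rs: "r \<in> {\<sigma>\<^sub>0<..}" "s \<in> {\<sigma>\<^sub>0<..}" "r < s"
    then have pos: "0 < r" "0 < s"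
      using \<open>0 < \<sigma>\<^sub>0\<close> by auto
    have "c r < q\<^sup>2"
      using c_less[of \<sigma>\<^sub>0 r] c0 rs \<open>0 < \<sigma>\<^sub>0\<close> by auto
    \<comment> \<open>For \<open>r * sqrt (2 * pi) > 1\<close> the reference point \<open>c r\<close> is negative, outside the range of the
      formula for the distribution function; clipping it at \<open>0\<close> only enlarges the event.\<close>
    have "std_normal.prob {y \<in> space std_normal. y\<^sup>2 / 2 \<le> c r}
        \<le> std_normal.prob {y \<in> space std_normal. y\<^sup>2 / 2 \<le> max (c r) 0}"
      by (intro std_normal.finite_measure_mono) auto
    also have "\<dots> = 2 / sqrt pi * gauss_integral (sqrt (max (c r) 0))"
      by (rule half_square_cdf) simp
    also have "\<dots> < 2 / sqrt pi * gauss_integral q"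
      using \<open>0 < q\<close> \<open>c r < q\<^sup>2\<close>
      by (intro mult_strict_left_mono strict_mono_onD[OF gauss_integral_strict_mono])
        (auto intro!: real_less_lsqrt simp: max_def)
    also have "\<dots> = 1 / 2"
      using q by simp
    finally have "std_normal.prob {y \<in> space std_normal. y\<^sup>2 / 2 \<le> c r} < 1 / 2" .
    then show "shannon_alt1 (normal_density 0 r) < shannon_alt1 (normal_density 0 s)"
      using pos rs abs_deviation(1)[of "c s" "c r"] c_less[of r s] by (simp add: H1)
  qed
qed

theorem proposition1:
  shows "(\<exists>\<sigma>\<^sub>0::real.
             (\<forall>s::real. 0 < s \<and> 0 < - ln (s * sqrt (2 * pi)) \<and>
                 (LBINT z:{0..- ln (s * sqrt (2 * pi))}. exp (- z) / sqrt z)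
                   = (LBINT z:{- ln (s * sqrt (2 * pi))..}. exp (- z) / sqrt z)
               \<longleftrightarrow> s = \<sigma>\<^sub>0)
           \<and> \<bar>\<sigma>\<^sub>0 - 0.317777\<bar> \<le> 0.0000005
           \<and> strict_antimono_on {0<..<\<sigma>\<^sub>0} (\<lambda>\<sigma>. shannon_alt1 (normal_density 0 \<sigma>))
           \<and> strict_mono_on {\<sigma>\<^sub>0<..} (\<lambda>\<sigma>. shannon_alt1 (normal_density 0 \<sigma>)))
       \<and> (\<forall>H \<in> {shannon_alt2, shannon_alt3, shannon_alt4}.
             strict_mono_on {0<..} (\<lambda>\<sigma>::real. H (normal_density 0 \<sigma>))
           \<and> ((\<lambda>\<sigma>. H (normal_density 0 \<sigma>)) \<longlongrightarrow> 0) (at_right 0)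
           \<and> filterlim (\<lambda>\<sigma>. H (normal_density 0 \<sigma>)) at_top at_top)"
proof -
  obtain q where q: "0.476935 \<le> q" "q \<le> 0.4769364"
    "\<And>b. 0 \<le> b \<Longrightarrow> gauss_integral b = sqrt pi / 4 \<longleftrightarrow> b = q"
    using gauss_integral_quartile by blast
  then have "0 < q" by simp
  with q(3)[of q] have "gauss_integral q = sqrt pi / 4" by simp
  show ?thesis
  proof (intro conjI exI[of _ "exp (- q\<^sup>2) / sqrt (2 * pi)"] allI ballI)
    show "\<bar>exp (- q\<^sup>2) / sqrt (2 * pi) - 0.317777\<bar> \<le> 0.0000005"
      by (rule critical_deviation_bounds[OF q(1,2)])
    fix s :: real
    show "0 < s \<and> 0 < - ln (s * sqrt (2 * pi)) \<and>
        (LBINT z:{0..- ln (s * sqrt (2 * pi))}. exp (- z) / sqrt z)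
          = (LBINT z:{- ln (s * sqrt (2 * pi))..}. exp (- z) / sqrt z)
      \<longleftrightarrow> s = exp (- q\<^sup>2) / sqrt (2 * pi)"
      by (rule gamma_balance_iff[OF \<open>0 < q\<close> q(3)])
  next
    fix H assume "H \<in> {shannon_alt2, shannon_alt3, shannon_alt4}"
    then consider "H = shannon_alt2" | "H = shannon_alt3" | "H = shannon_alt4" by blast
    then have *: "strict_mono_on {0<..} (\<lambda>\<sigma>. H (normal_density 0 \<sigma>))
        \<and> ((\<lambda>\<sigma>. H (normal_density 0 \<sigma>)) \<longlongrightarrow> 0) (at_right 0)
        \<and> filterlim (\<lambda>\<sigma>. H (normal_density 0 \<sigma>)) at_top at_top"
    proof cases
      case 1
      with positive_part.normal_entropy_monotone_limits[OF shannon_alt2_normal]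
      show ?thesis by blast
    next
      case 2
      with softplus.normal_entropy_monotone_limits[OF shannon_alt3_normal]
      show ?thesis by blast
    next
      case 3
      with shannon_alt4_normal_monotone_limits show ?thesis by blast
    qed
    show "strict_mono_on {0<..} (\<lambda>\<sigma>. H (normal_density 0 \<sigma>))"
      and "((\<lambda>\<sigma>. H (normal_density 0 \<sigma>)) \<longlongrightarrow> 0) (at_right 0)"
      and "filterlim (\<lambda>\<sigma>. H (normal_density 0 \<sigma>)) at_top at_top"
      using * by blast+
  qed (rule shannon_alt1_normal_monotone[OF \<open>0 < q\<close> \<open>gauss_integral q = sqrt pi / 4\<close>])+
qed

end
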